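(* For every integer $n\ge 0$, the number of $n$-step basketball walks from $0$ to $1$ that are positive except at the origin is equal to the number of $n$-vertex increasing unary-binary trees whose associated permutation avoids the pattern $213$.
   Context: A basketball walk is a finite sequence of integers $(w_0,\ldots,w_n)$ with $w_0=0$ and each step $w_i-w_{i-1}\in\{-2,-1,+1,+2\}$; "from $0$ to $1$, positive except at the origin" means $w_n=1$ and $w_i>0$ for $1\le i\le n$. A unary-binary tree of size $n\ge1$ is a rooted plane tree with $n$ vertices in which every vertex has $0$, $1$ or $2$ children (so there are no such trees with $0$ vertices). It is increasing if its vertices are bijectively labeled by $1,\ldots,n$ so that every non-root vertex has a label larger than that of its parent. The associated permutation of an increasing tree is the sequence of labels read in breadth-first search order, from left to right within each generation. A permutation $\sigma=(\sigma_1,\ldots,\sigma_n)$ avoids $213$ if there are no indices $i_1<i_2<i_3$ with $\sigma_{i_2}<\sigma_{i_1}<\sigma_{i_3}$. *)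

theory Defs
  imports Main
begin

definition basketball_walk :: "int list \<Rightarrow> bool" where
  "basketball_walk w \<longleftrightarrow>
     w \<noteq> [] \<and> w ! 0 = 0 \<and>
     (\<forall>i \<in> {1..<length w}. w ! i - w ! (i - 1) \<in> {-2, -1, 1, 2})"

text \<open>An \<open>n\<close>-step walk \<open>(w\<^sub>0, \<dots>, w\<^sub>n)\<close> is a list of length \<open>n + 1\<close>.\<close>

definition positive_walks_0_1 :: "nat \<Rightarrow> int list set" where
  "positive_walks_0_1 n =
     {w. length w = n + 1 \<and> basketball_walk w \<and> w ! n = 1 \<and> (\<forall>i \<in> {1..n}. 0 < w ! i)}"

datatype 'a ub_tree =
    Leaf (root: 'a)
  | Unary (root: 'a) "'a ub_tree"
  | Binary (root: 'a) "'a ub_tree" "'a ub_tree"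

fun children :: "'a ub_tree \<Rightarrow> 'a ub_tree list" where
  "children (Leaf a) = []"
| "children (Unary a t) = [t]"
| "children (Binary a l r) = [l, r]"

text \<open>One entry per vertex, so its length is the number of vertices of the tree.\<close>

fun labels :: "'a ub_tree \<Rightarrow> 'a list" where
  "labels (Leaf a) = [a]"
| "labels (Unary a t) = a # labels t"
| "labels (Binary a l r) = a # labels l @ labels r"

fun increasing :: "'a::linorder ub_tree \<Rightarrow> bool" where
  "increasing (Leaf a) \<longleftrightarrow> True"
| "increasing (Unary a t) \<longleftrightarrow> a < root t \<and> increasing t"
| "increasing (Binary a l r) \<longleftrightarrow> a < root l \<and> a < root r \<and> increasing l \<and> increasing r"

definition increasing_ub_trees :: "nat \<Rightarrow> nat ub_tree set" where
  "increasing_ub_trees n =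
     {t. length (labels t) = n \<and> distinct (labels t) \<and> set (labels t) = {1..n} \<and> increasing t}"

text \<open>The argument of \<open>bfs_forest\<close> lists the subtrees rooted at the vertices of one
  generation, from left to right; the recursive call moves on to the next generation.\<close>

function bfs_forest :: "'a ub_tree list \<Rightarrow> 'a list" where
  "bfs_forest [] = []"
| "bfs_forest (t # ts) = map root (t # ts) @ bfs_forest (concat (map children (t # ts)))"
  by pat_completeness auto
termination
proof (relation "measure (\<lambda>ts. \<Sum>t\<leftarrow>ts. length (labels t))", goal_cases)
  case 1
  show ?case by simp
next
  case (2 t ts)
  have *: "(\<Sum>s\<leftarrow>children u. length (labels s)) < length (labels u)" for u :: "'a ub_tree"
    by (cases u) auto
  have "(\<Sum>s\<leftarrow>concat (map children us). length (labels s)) \<le> (\<Sum>u\<leftarrow>us. length (labels u))"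
    for us :: "'a ub_tree list"
  proof (induction us)
    case (Cons u us)
    then show ?case using *[of u] by simp
  qed simp
  from this[of ts] show ?case using *[of t] by simp
qed

definition associated_permutation :: "'a ub_tree \<Rightarrow> 'a list" where
  "associated_permutation t = bfs_forest [t]"

definition avoids_213 :: "'a::linorder list \<Rightarrow> bool" where
  "avoids_213 \<sigma> \<longleftrightarrow>
     \<not> (\<exists>i j k. i < j \<and> j < k \<and> k < length \<sigma> \<and> \<sigma> ! j < \<sigma> ! i \<and> \<sigma> ! i < \<sigma> ! k)"

end

theory Submission
  imports "HOL-Computational_Algebra.Formal_Power_Series" Defs
begin

text \<open>
  Both families have the generating function \<open>T\<close> with \<open>T\<^sub>0 = 0\<close> and
  \<open>X (1 + T + T\<^sup>2)\<^sup>2 = T (1 + T)\<close>.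

  The numbers of positive walks from \<open>0\<close> to \<open>h\<close> are determined by the last-step recurrence. Writing
  \<open>P = T / (1 + T)\<close>, it is solved by the sequence of series with \<open>U\<^sub>0 = 1\<close>, \<open>U\<^sub>1 = T\<close>,
  \<open>U\<^bsub>h+1\<^esub> = T U\<^sub>h + P U\<^bsub>h-1\<^esub>\<close>, because \<open>y\<^sup>2 - T y - P\<close> divides the kernel
  \<open>y\<^sup>2 - X (1 + y + y\<^sup>3 + y\<^sup>4)\<close>.

  On the tree side, delete the vertices in breadth-first order. What remains is a forest with
  \<open>q\<close> trees whose reading word avoids 213 and has \<open>j\<close> left-to-right minima. Conversely, a new first
  vertex is either a leaf, whose label can be chosen in \<open>j + 1\<close> ways, leading to \<open>q + 1\<close> trees and
  each of \<open>1, \<dots>, j + 1\<close> minima once; or it takes the last one or two trees as children, and then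
  avoidance of 213 forces its label to be the smallest. With \<open>c = 1 + T P\<close>, the weight
  \<open>T\<^sup>q c\<^bsup>j-1\<^esup>\<close> of a forest equals \<open>X\<close> times the total weight of its extensions, except that
  a single tree contributes an additional \<open>X\<close>. Iterating from the one-vertex forest of
  weight \<open>T\<close> shows that the coefficients of \<open>T\<close> count the trees.
\<close>

unbundle fps_syntax

subsection \<open>Positive basketball walks\<close>

text \<open>\<open>A\<close> has constant term 0 and linear coefficient 1, so it has a compositional
  inverse \<open>T\<close>; composing with \<open>T\<close> turns the definition of \<open>A\<close>
  into the equation \<open>key\<close>. Dividing that by the square of \<open>1 + T\<close> gives
  the formula for \<open>P\<close>.\<close>

lemma walk_series_exists:
  obtains T P c :: "rat fps"
  where "T $ 0 = 0" "P * (1 + T) = T" "c = 1 + T * P" "P = fps_X * c\<^sup>2"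
proof -
  define A :: "rat fps" where "A = fps_X * (1 + fps_X) * inverse ((1 + fps_X + fps_X\<^sup>2)\<^sup>2)"
  define T where "T = fps_inv A"
  have D0: "((1 + fps_X + fps_X\<^sup>2)\<^sup>2 :: rat fps) $ 0 = 1"
    by (simp add: power2_eq_square)
  have A0: "A $ 0 = 0" and A1: "A $ 1 \<noteq> 0"
    by (simp_all add: A_def fps_mult_nth_1 D0)
  have T0: "T $ 0 = 0"
    by (simp add: T_def fps_inv_def)
  have "A * (1 + fps_X + fps_X\<^sup>2)\<^sup>2 = fps_X * (1 + fps_X)"
    using inverse_mult_eq_1[of "(1 + fps_X + fps_X\<^sup>2)\<^sup>2 :: rat fps"] D0
    by (simp add: A_def mult.assoc)
  then have "(A * (1 + fps_X + fps_X\<^sup>2)\<^sup>2) oo T = (fps_X * (1 + fps_X)) oo T"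
    by simp
  moreover have "A oo T = fps_X"
    unfolding T_def by (rule fps_inv_right[OF A0 A1])
  ultimately have key: "fps_X * (1 + T + T\<^sup>2)\<^sup>2 = T * (1 + T)"
    using T0 by (simp add: fps_compose_mult_distrib fps_compose_add_distrib fps_compose_power[symmetric])
  define P where "P = T * inverse (1 + T)"
  define c where "c = 1 + T * P"
  have nz: "1 + T \<noteq> 0"
  proof
    assume "1 + T = 0"
    then have "(1 + T) $ 0 = 0" by simp
    then show False using T0 by simp
  qed
  have P: "P * (1 + T) = T"
    using T0 inverse_mult_eq_1[of "1 + T"] by (simp add: P_def mult.assoc)
  have c: "c * (1 + T) = 1 + T + T\<^sup>2"
  proof -
    have "c * (1 + T) = 1 + T + T * (P * (1 + T))"
      unfolding c_def by (simp add: algebra_simps)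
    then show ?thesis by (simp only: P power2_eq_square)
  qed
  have "fps_X * c\<^sup>2 * (1 + T)\<^sup>2 = fps_X * (c * (1 + T))\<^sup>2"
    by (simp add: power_mult_distrib mult.assoc)
  also have "\<dots> = P * (1 + T) * (1 + T)"
    by (simp only: c key P)
  finally have "fps_X * c\<^sup>2 * (1 + T)\<^sup>2 = P * (1 + T)\<^sup>2"
    by (simp add: power2_eq_square mult.assoc)
  then have "P = fps_X * c\<^sup>2"
    using nz by simp
  with T0 P c_def show thesis by (intro that)
qed

text \<open>Both sides reduce to combinations of \<open>V (k + 1)\<close> and \<open>V k\<close>,
  whose coefficients agree by \<open>T'\<close> and \<open>P'\<close>. This is the divisibility of
  the kernel, multiplied out.\<close>

lemma positive_walk_recurrence:
  fixes X T P c :: "'a::idom" and V :: "nat \<Rightarrow> 'a"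
  assumes P: "P * (1 + T) = T" and c: "c = 1 + T * P" and PX: "P = X * c\<^sup>2"
    and V: "\<And>k. V (k + 2) = T * V (k + 1) + P * V k"
  shows "V (k + 2) = X * (V k + V (k + 1) + V (k + 3) + V (k + 4))"
proof -
  have V3: "V (k + 3) = T * V (k + 2) + P * V (k + 1)" using V[of "k + 1"] by (simp add: numeral_eq_Suc)
  have V4: "V (k + 4) = T * V (k + 3) + P * V (k + 2)" using V[of "k + 2"] by (simp add: numeral_eq_Suc)
  have "c\<^sup>2 = 1 + T * P + T\<^sup>2 * P + P\<^sup>2"
    using c P by algebra
  then have P': "X * (1 + T * P + T\<^sup>2 * P + P\<^sup>2) = P"
    using PX by simp
  have "c\<^sup>2 * (1 + T) = 1 + T\<^sup>2 + P + T ^ 3 + 2 * T * P"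
    using c P by algebra
  then have T': "X * (1 + T\<^sup>2 + P + T ^ 3 + 2 * T * P) = T"
    using P PX by (metis mult.assoc)
  have "V k + V (k + 1) + V (k + 3) + V (k + 4) =
      (1 + T\<^sup>2 + P + T ^ 3 + 2 * T * P) * V (k + 1) + (1 + T * P + T\<^sup>2 * P + P\<^sup>2) * V k"
    unfolding V4 V3 V by (simp add: algebra_simps power2_eq_square power3_eq_cube)
  then have "X * (V k + V (k + 1) + V (k + 3) + V (k + 4)) =
      (X * (1 + T\<^sup>2 + P + T ^ 3 + 2 * T * P)) * V (k + 1) +
      (X * (1 + T * P + T\<^sup>2 * P + P\<^sup>2)) * V k"
    by (simp add: algebra_simps)
  then show ?thesis
    by (simp only: P' T' V)
qed

text \<open>The end point is an arbitrary integer so that the last-step recurrence at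
  \<open>h = 1\<close> can refer to \<open>h - 2\<close>, where there are no walks.\<close>

definition positive_walks :: "nat \<Rightarrow> int \<Rightarrow> int list set" where
  "positive_walks n h =
     {w. length w = n + 1 \<and> basketball_walk w \<and> w ! n = h \<and> (\<forall>i \<in> {1..n}. 0 < w ! i)}"

lemma positive_walks_0: "positive_walks 0 h = (if h = 0 then {[0]} else {})"
  by (auto simp: positive_walks_def basketball_walk_def length_Suc_conv)

lemma positive_walks_snoc:
  assumes "length w = Suc n"
  shows "w @ [h] \<in> positive_walks (Suc n) h \<longleftrightarrow>
    0 < h \<and> h - w ! n \<in> {-2, -1, 1, 2} \<and> w \<in> positive_walks n (w ! n)"
proof -
  have 1: "{1..<Suc (Suc n)} = insert (Suc n) {1..<Suc n}" "{1..Suc n} = insert (Suc n) {1..n}"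
    by auto
  have 2: "(w @ [h]) ! i = w ! i" if "i < Suc n" for i
    using assms that by (simp add: nth_append)
  have 3: "(w @ [h]) ! Suc n = h"
    using assms by (simp add: nth_append)
  have 4: "(\<forall>i\<in>{1..<Suc n}. (w @ [h]) ! i - (w @ [h]) ! (i - 1) \<in> {-2, -1, 1, 2}) \<longleftrightarrow>
      (\<forall>i\<in>{1..<Suc n}. w ! i - w ! (i - 1) \<in> {-2, -1, 1, 2})"
    by (intro ball_cong) (auto simp: 2)
  have 5: "(\<forall>i\<in>{1..n}. 0 < (w @ [h]) ! i) \<longleftrightarrow> (\<forall>i\<in>{1..n}. 0 < w ! i)"
    by (intro ball_cong) (auto simp: 2)
  have 6: "w \<noteq> []" using assms by auto
  show ?thesis
    unfolding positive_walks_def basketball_walk_def mem_Collect_eq length_append_singleton assms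
      1 ball_simps(7) 3 4 5
    using assms 2[of 0] 2[of n] 6 by auto
qed

lemma positive_walks_Suc:
  "positive_walks (Suc n) h =
     (if 0 < h then (\<lambda>w. w @ [h]) ` (\<Union>g \<in> {h - 2, h - 1, h + 1, h + 2}. positive_walks n g) else {})"
    (is "_ = ?R")
proof (rule set_eqI)
  fix x
  show "x \<in> positive_walks (Suc n) h \<longleftrightarrow> x \<in> ?R"
  proof (cases "\<exists>w. length w = Suc n \<and> x = w @ [h]")
    case True
    then obtain w where w: "length w = Suc n" "x = w @ [h]" by blast
    have g: "w \<in> positive_walks n g \<longleftrightarrow> g = w ! n \<and> w \<in> positive_walks n (w ! n)" for g
      by (auto simp: positive_walks_def)
    have ex: "(\<exists>g\<in>G. g = z \<and> Q) \<longleftrightarrow> z \<in> G \<and> Q" for G and z :: int and Q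
      by blast
    have "x \<in> ?R \<longleftrightarrow> 0 < h \<and> (\<exists>g\<in>{h - 2, h - 1, h + 1, h + 2}. w \<in> positive_walks n g)"
      unfolding w(2) by (simp add: image_iff)
    also have "\<dots> \<longleftrightarrow> 0 < h \<and> w ! n \<in> {h - 2, h - 1, h + 1, h + 2} \<and> w \<in> positive_walks n (w ! n)"
      by (subst g) (simp only: ex)
    also have "w ! n \<in> {h - 2, h - 1, h + 1, h + 2} \<longleftrightarrow> h - w ! n \<in> {-2, -1, 1, 2}"
      by auto
    finally show ?thesis
      using positive_walks_snoc[OF w(1), of h] w(2) by simp
  next
    case False
    have "x \<notin> positive_walks (Suc n) h"
    proof
      assume x: "x \<in> positive_walks (Suc n) h"
      then have "length x = Suc (Suc n)" "x ! Suc n = h" by (auto simp: positive_walks_def)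
      then have "x = butlast x @ [h]" "length (butlast x) = Suc n"
        using append_butlast_last_id[of x] last_conv_nth[of x] by (cases "x = []"; simp)+
      with False show False by blast
    qed
    moreover have "x \<notin> ?R" using False by (auto simp: positive_walks_def)
    ultimately show ?thesis by simp
  qed
qed

lemma finite_positive_walks: "finite (positive_walks n h)"
  by (induction n arbitrary: h) (auto simp: positive_walks_0 positive_walks_Suc)

lemma card_positive_walks_Suc:
  assumes "0 < h"
  shows "card (positive_walks (Suc n) h) =
     card (positive_walks n (h - 2)) + card (positive_walks n (h - 1)) +
     card (positive_walks n (h + 1)) + card (positive_walks n (h + 2))"
proof -
  have disj: "positive_walks n g \<inter> positive_walks n g' = {}" if "g \<noteq> g'" for g g'
    using that by (auto simp: positive_walks_def)
  have "card (positive_walks (Suc n) h) = card (\<Union>g \<in> {h - 2, h - 1, h + 1, h + 2}. positive_walks n g)"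
    unfolding positive_walks_Suc using assms by (simp only: if_True) (rule card_image, auto simp: inj_on_def)
  also have "\<dots> = (\<Sum>g \<in> {h - 2, h - 1, h + 1, h + 2}. card (positive_walks n g))"
    by (intro card_UN_disjoint) (auto simp: finite_positive_walks disj)
  finally show ?thesis by simp
qed

lemma positive_walks_neg: "h < 0 \<Longrightarrow> positive_walks n h = {}"
  by (cases n) (auto simp: positive_walks_0 positive_walks_Suc)

text \<open>Indices are shifted by one: \<open>V k\<close> belongs to height \<open>k - 1\<close>.
  The term \<open>V 0 = 0\<close> for height -1 lets the recurrence start at height 1;
  \<open>V 1 = 1\<close> counts the walk without steps, the only one ending at 0.\<close>

lemma card_positive_walks_eq_nth:
  fixes T P c :: "rat fps" and V :: "nat \<Rightarrow> rat fps"
  assumes T0: "T $ 0 = 0" and P: "P * (1 + T) = T" and c: "c = 1 + T * P" and PX: "P = fps_X * c\<^sup>2"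
    and V0: "V 0 = 0" and V1: "V 1 = 1" and V: "\<And>k. V (k + 2) = T * V (k + 1) + P * V k"
  shows "of_nat (card (positive_walks n (int k - 1))) = V k $ n"
proof (induction n arbitrary: k)
  case 0
  have "P $ 0 = 0" by (simp add: PX)
  consider "k = 0" | "k = 1" | l where "k = l + 2"
    by (metis One_nat_def Suc_1 add_2_eq_Suc' not0_implies_Suc)
  then show ?case
  proof cases
    case (3 l)
    then show ?thesis using V[of l] T0 \<open>P $ 0 = 0\<close> by (simp add: positive_walks_0)
  qed (use V0 V1 in \<open>simp_all add: positive_walks_0\<close>)
next
  case (Suc n)
  consider "k = 0" | "k = 1" | l where "k = l + 2"
    by (metis One_nat_def Suc_1 add_2_eq_Suc' not0_implies_Suc)
  then show ?case
  proof cases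
    case (3 l)
    have "V k $ Suc n = V l $ n + V (l + 1) $ n + V (l + 3) $ n + V (l + 4) $ n"
      unfolding 3 positive_walk_recurrence[OF P c PX V, of l] by simp
    then show ?thesis
      using card_positive_walks_Suc[of "int l + 1" n] Suc[of l] Suc[of "l + 1"] Suc[of "l + 3"] Suc[of "l + 4"]
      by (simp add: 3 algebra_simps)
  qed (auto simp: positive_walks_neg positive_walks_Suc V0 V1[simplified])
qed

lemma card_positive_walks_0_1:
  fixes T P c :: "rat fps"
  assumes "T $ 0 = 0" "P * (1 + T) = T" "c = 1 + T * P" "P = fps_X * c\<^sup>2"
  shows "of_nat (card (positive_walks_0_1 n)) = T $ n"
proof -
  \<comment> \<open>\<open>U k\<close> holds the two consecutive terms \<open>V k\<close> and
    \<open>V (k + 1)\<close>.\<close>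
  define U where "U = rec_nat (0 :: rat fps, 1) (\<lambda>_ (a, b). (b, T * b + P * a))"
  define V where "V k = fst (U k)" for k
  have V0: "V 0 = 0" and V1: "V 1 = 1" and V: "V (k + 2) = T * V (k + 1) + P * V k" for k
    by (simp_all add: V_def U_def split: prod.split)
  have "V 2 = T" using V[of 0] V0 V1 by (simp add: numeral_2_eq_2)
  then show ?thesis
    using card_positive_walks_eq_nth[OF assms V0 V1 V, of n 2]
    by (simp add: positive_walks_def positive_walks_0_1_def)
qed

text \<open>The ranks of the elements of \<open>B\<close> are 0 up to \<open>card B - 1\<close>,
  each taken once: a new maximum receives the next rank and leaves the others unchanged.\<close>

lemma sum_card_less:
  fixes B :: "'a::linorder set" and f :: "nat \<Rightarrow> 'b::comm_monoid_add"
  assumes "finite B"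
  shows "(\<Sum>v\<in>B. f (card {x\<in>B. x < v})) = (\<Sum>i<card B. f i)"
  using assms
proof (induction B rule: finite_linorder_max_induct)
  case (insert b A)
  have b: "b \<notin> A" using insert by auto
  have "{x \<in> insert b A. x < v} = {x\<in>A. x < v}" if "v \<in> A" for v
    using insert that by (auto dest: less_asym)
  moreover have "{x \<in> insert b A. x < b} = A"
    using insert by auto
  ultimately show ?case
    using insert b by (simp add: add.commute)
qed simp

subsection \<open>Insertion into words avoiding 213\<close>

text \<open>The condition on \<open>w\<close> for \<open>a\<close> not to be the \<open>2\<close> of a 213 pattern in \<open>a # w\<close>, phrased so
  that it also makes sense if \<open>a\<close> occurs in \<open>w\<close>, in which case it treats that entry as larger
  than \<open>a\<close>. Hence it is unchanged by the relabelling \<open>shift a\<close> below.\<close>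

fun low_after :: "'a::linorder \<Rightarrow> 'a list \<Rightarrow> bool" where
  "low_after a [] \<longleftrightarrow> True"
| "low_after a (b # w) \<longleftrightarrow> (b < a \<longrightarrow> (\<forall>x\<in>set w. x < a)) \<and> low_after a w"

lemma low_after_iff:
  "low_after a w \<longleftrightarrow> (\<forall>i j. i < j \<and> j < length w \<and> w ! i < a \<longrightarrow> w ! j < a)"
proof (induction w)
  case (Cons b w)
  let ?Q = "\<lambda>u i j. i < j \<and> j < length u \<and> u ! i < a \<longrightarrow> u ! j < a"
  have "(\<forall>i j. ?Q (b # w) i j) \<longleftrightarrow> (\<forall>j. ?Q (b # w) 0 (Suc j)) \<and> (\<forall>i j. ?Q (b # w) (Suc i) (Suc j))"
  proof (intro iffI allI)
    fix i j
    assume "(\<forall>j. ?Q (b # w) 0 (Suc j)) \<and> (\<forall>i j. ?Q (b # w) (Suc i) (Suc j))"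
    then show "?Q (b # w) i j" by (cases i; cases j) blast+
  qed blast
  also have "\<dots> \<longleftrightarrow> (b < a \<longrightarrow> (\<forall>x\<in>set w. x < a)) \<and> (\<forall>i j. ?Q w i j)"
    unfolding all_set_conv_all_nth by auto
  finally show ?case
    using Cons by simp
qed simp

lemma avoids_213_Cons:
  assumes "a \<notin> set w"
  shows "avoids_213 (a # w) \<longleftrightarrow> low_after a w \<and> avoids_213 w"
proof -
  have "avoids_213 (a # w) \<longleftrightarrow>
      \<not> (\<exists>j k. j < k \<and> k < length w \<and> w ! j < a \<and> a < w ! k) \<and> avoids_213 w" (is "?L \<longleftrightarrow> \<not> ?A \<and> ?B")
  proof
    assume ?L
    then have L: "\<not> (i < j \<and> j < k \<and> k < Suc (length w) \<and> (a # w) ! j < (a # w) ! i \<and> (a # w) ! i < (a # w) ! k)" for i j k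
      by (auto simp: avoids_213_def)
    have "\<not> ?A" using L[of 0 "Suc _" "Suc _"] by auto
    moreover have ?B unfolding avoids_213_def using L[of "Suc _" "Suc _" "Suc _"] by auto
    ultimately show "\<not> ?A \<and> ?B" ..
  next
    assume R: "\<not> ?A \<and> ?B"
    have "\<not> (i < j \<and> j < k \<and> k < Suc (length w) \<and> (a # w) ! j < (a # w) ! i \<and> (a # w) ! i < (a # w) ! k)" for i j k
      using R by (cases i; cases j; cases k) (auto simp: avoids_213_def)
    then show ?L by (auto simp: avoids_213_def)
  qed
  moreover have "\<not> ?A \<longleftrightarrow> low_after a w"
    unfolding low_after_iff using assms by (metis nth_mem not_less_iff_gr_or_eq)
  ultimately show ?thesis by blast
qed

text \<open>Minima are recorded as values, not positions, because these values are the labels that a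
  new first letter may take.\<close>

fun lr_minima :: "'a::linorder list \<Rightarrow> 'a set" where
  "lr_minima [] = {}"
| "lr_minima (a # w) = insert a {x \<in> lr_minima w. x < a}"

lemma lr_minima_subset: "lr_minima w \<subseteq> set w"
  by (induction w) auto

lemma finite_lr_minima: "finite (lr_minima w)"
  using finite_subset[OF lr_minima_subset] by blast

text \<open>Since \<open>v\<close> itself counts as not below \<open>v\<close>, nothing smaller may
  precede it. Conversely, if \<open>v\<close> is a left-to-right minimum, a smaller entry followed
  by a larger one would both come after \<open>v\<close> and form a 213 pattern with it.\<close>

lemma low_after_iff_lr_minima:
  assumes "distinct w" "avoids_213 w" "v \<in> set w"
  shows "low_after v w \<longleftrightarrow> v \<in> lr_minima w"
  using assms
proof (induction w)
  case (Cons b w)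
  then have "low_after b w" "avoids_213 w"
    by (auto simp: avoids_213_Cons)
  with Cons lr_minima_subset[of w] show ?case
    by (cases "v = b") auto
qed simp

lemma low_after_greater: "(\<forall>x\<in>set w. x < v) \<Longrightarrow> low_after v w"
  by (induction w) auto

lemma low_after_least: "(\<forall>x\<in>set w. v \<le> x) \<Longrightarrow> low_after v w"
  by (induction w) auto

lemma avoids_213_map:
  fixes f :: "'a::linorder \<Rightarrow> 'b::linorder"
  assumes "strict_mono f"
  shows "avoids_213 (map f w) \<longleftrightarrow> avoids_213 w"
  unfolding avoids_213_def by (simp add: strict_mono_less[OF assms] cong: conj_cong)

lemma lr_minima_map:
  fixes f :: "'a::linorder \<Rightarrow> 'b::linorder"
  assumes "strict_mono f"
  shows "lr_minima (map f w) = f ` lr_minima w"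
  by (induction w) (auto simp: strict_mono_less[OF assms])

section \<open>Relabelling that opens or closes a gap at one label\<close>

definition shift :: "nat \<Rightarrow> nat \<Rightarrow> nat" where
  "shift v x = (if v \<le> x then Suc x else x)"

definition unshift :: "nat \<Rightarrow> nat \<Rightarrow> nat" where
  "unshift v x = (if v < x then x - 1 else x)"

lemma strict_mono_shift: "strict_mono (shift v)"
  by (auto simp: shift_def strict_mono_def)

lemma unshift_shift [simp]: "unshift v (shift v x) = x"
  by (auto simp: shift_def unshift_def)

lemma shift_unshift: "x \<noteq> v \<Longrightarrow> shift v (unshift v x) = x"
  by (auto simp: shift_def unshift_def)

lemma shift_less_iff [simp]: "shift v x < v \<longleftrightarrow> x < v"
  by (auto simp: shift_def)

lemma less_shift_iff [simp]: "v < shift v x \<longleftrightarrow> v \<le> x"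
  by (auto simp: shift_def)

lemma shift_neq [simp]: "shift v x \<noteq> v" "v \<noteq> shift v x"
  by (auto simp: shift_def)

text \<open>\<open>shift v\<close> carries \<open>{1..m}\<close> onto \<open>{1..Suc m}\<close>
  without \<open>v\<close>, and by injectivity no other set has this image.\<close>

lemma insert_shift_image:
  assumes "v \<in> {1..Suc m}"
  shows "insert v (shift v ` A) = {1..Suc m} \<longleftrightarrow> A = {1..m}"
proof -
  have *: "insert v (shift v ` {1..m}) = {1..Suc m}"
  proof
    show "{1..Suc m} \<subseteq> insert v (shift v ` {1..m})"
    proof
      fix x assume x: "x \<in> {1..Suc m}"
      show "x \<in> insert v (shift v ` {1..m})"
      proof (cases "x = v")
        case False
        then have "unshift v x \<in> {1..m}" using x assms by (auto simp: unshift_def)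
        then show ?thesis using shift_unshift[OF False] by (metis image_eqI insertI2)
      qed simp
    qed
  qed (use assms in \<open>auto simp: shift_def\<close>)
  have "A = B" if "insert v (shift v ` A) = insert v (shift v ` B)" for A B
  proof -
    have "shift v ` A = shift v ` B"
      using that by (subst (asm) insert_ident) auto
    then show ?thesis
      by (metis inj_image_eq_iff strict_mono_imp_inj_on strict_mono_shift)
  qed
  with * show ?thesis by metis
qed

lemma low_after_shift: "low_after v (map (shift v) w) \<longleftrightarrow> low_after v w"
  by (induction w) auto

text \<open>A new first letter can take the place of a left-to-right minimum, pushing it up, or be the
  new maximum.\<close>

definition insertable :: "nat list \<Rightarrow> nat set" where
  "insertable w = insert (Suc (length w)) (lr_minima w)"

lemma insertable_iff:
  assumes "distinct w" "set w = {1..m}" "avoids_213 w"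
  shows "v \<in> {1..Suc m} \<and> low_after v w \<longleftrightarrow> v \<in> insertable w"
proof -
  have "length w = m" using assms distinct_card[of w] by simp
  then show ?thesis
    using low_after_iff_lr_minima[OF assms(1,3), of v] low_after_greater[of w v] lr_minima_subset[of w] assms(2)
    unfolding insertable_def by (auto simp: le_Suc_eq)
qed

text \<open>The minima after the insertion are \<open>v\<close> and the old minima below
  \<open>v\<close>, which the shift does not move. Their number is one more than the rank of
  \<open>v\<close> in \<open>insertable w\<close>, and the ranks run from 0 to
  \<open>card (lr_minima w)\<close>.\<close>

lemma sum_insertable:
  fixes h :: "nat \<Rightarrow> 'b::comm_monoid_add"
  assumes "set w = {1..m}" "length w = m"
  shows "(\<Sum>v\<in>insertable w. h (card (lr_minima (v # map (shift v) w)))) =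
    (\<Sum>i\<le>card (lr_minima w). h (Suc i))"
proof -
  have max: "x < Suc (length w)" if "x \<in> lr_minima w" for x
    using that lr_minima_subset[of w] assms by (auto simp: less_Suc_eq_le)
  have "card (lr_minima (v # map (shift v) w)) = Suc (card {x \<in> insertable w. x < v})"
    if v: "v \<in> insertable w" for v
  proof -
    have "{x \<in> lr_minima (map (shift v) w). x < v} = {x \<in> insertable w. x < v}"
      unfolding lr_minima_map[OF strict_mono_shift]
      using v by (auto simp: insertable_def image_iff shift_def dest: max)
    then show ?thesis
      by (simp add: insertable_def finite_lr_minima)
  qed
  then have "(\<Sum>v\<in>insertable w. h (card (lr_minima (v # map (shift v) w)))) =
      (\<Sum>v\<in>insertable w. h (Suc (card {x \<in> insertable w. x < v})))"
    by (intro sum.cong) auto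
  also have "\<dots> = (\<Sum>i<card (insertable w). h (Suc i))"
    by (rule sum_card_less[where f = "\<lambda>i. h (Suc i)"]) (simp add: insertable_def finite_lr_minima)
  also have "card (insertable w) = Suc (card (lr_minima w))"
    using max finite_lr_minima[of w] unfolding insertable_def by (subst card_insert_disjoint) auto
  finally show ?thesis by (simp add: lessThan_Suc_atMost)
qed

subsection \<open>Breadth-first search\<close>

lemma size_children: "(\<Sum>s\<leftarrow>concat (map children us). length (labels s)) + length us = (\<Sum>u\<leftarrow>us. length (labels u))"
proof (induction us)
  case (Cons u us)
  then show ?case by (cases u) auto
qed simp

lemma bfs_forest_eq: "bfs_forest ts = map root ts @ bfs_forest (concat (map children ts))"
  by (cases ts) auto

text \<open>This leads to the queue form of the search, which deletes one vertex at a time. The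
  induction hypothesis is used with \<open>us\<close> as the prefix: reading \<open>us\<close> next
  completes the generation.\<close>

lemma bfs_forest_append:
  "bfs_forest (ts @ us) = map root ts @ bfs_forest (us @ concat (map children ts))"
proof (induction "\<Sum>t\<leftarrow>ts @ us. length (labels t)" arbitrary: ts us rule: less_induct)
  case less
  show ?case
  proof (cases "ts = []")
    case False
    then have "0 < length ts" by simp
    then have "(\<Sum>t\<leftarrow>us @ concat (map children ts). length (labels t)) < (\<Sum>t\<leftarrow>ts @ us. length (labels t))"
      using size_children[of ts] unfolding map_append sum_list_append by linarith
    from less[OF this] show ?thesis
      using bfs_forest_eq[of "ts @ us"] by simp
  qed simp
qed

lemma bfs_forest_Cons: "bfs_forest (t # ts) = root t # bfs_forest (ts @ children t)"
  using bfs_forest_append[of "[t]" ts] by simp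

lemma mset_bfs_forest: "mset (bfs_forest ts) = mset (concat (map labels ts))"
proof (induction ts rule: bfs_forest.induct)
  case (2 t ts)
  have "mset (concat (map labels us)) = mset (map root us) + mset (concat (map labels (concat (map children us))))"
    for us :: "'a ub_tree list"
  proof (induction us)
    case (Cons u us)
    then show ?case by (cases u) (auto simp: ac_simps)
  qed simp
  from this[of "t # ts"] 2 show ?case by simp
qed simp

lemma root_map_ub_tree: "root (map_ub_tree f t) = f (root t)"
  by (cases t) auto

lemma children_map_ub_tree: "children (map_ub_tree f t) = map (map_ub_tree f) (children t)"
  by (cases t) auto

lemma bfs_forest_map: "bfs_forest (map (map_ub_tree f) ts) = map f (bfs_forest ts)"
proof (induction ts rule: bfs_forest.induct)
  case (2 t ts)
  have "concat (map children (map (map_ub_tree f) us)) = map (map_ub_tree f) (concat (map children us))" for us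
    by (induction us) (auto simp: children_map_ub_tree)
  from this[of "t # ts"] 2 show ?case by (simp add: root_map_ub_tree)
qed simp

lemma set_ub_tree_eq: "set_ub_tree t = set (labels t)"
  by (induction t) auto

lemma increasing_map_ub_tree:
  fixes f :: "'a::linorder \<Rightarrow> 'b::linorder"
  assumes "strict_mono f"
  shows "increasing (map_ub_tree f t) \<longleftrightarrow> increasing t"
  by (induction t) (auto simp: root_map_ub_tree strict_mono_less[OF assms])

lemma increasing_root_le: "increasing t \<Longrightarrow> x \<in> set (labels t) \<Longrightarrow> root t \<le> x"
  by (induction t) fastforce+

lemma increasing_iff_children:
  "increasing t \<longleftrightarrow> (\<forall>c\<in>set (children t). root t < root c \<and> increasing c)"
  by (cases t) auto

declare bfs_forest.simps(2) [simp del]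

subsection \<open>Attaching a new first vertex to a forest\<close>

definition node :: "'a \<Rightarrow> 'a ub_tree list \<Rightarrow> 'a ub_tree" where
  "node v cs = (case cs of [] \<Rightarrow> Leaf v | [s] \<Rightarrow> Unary v s | s # t # _ \<Rightarrow> Binary v s t)"

lemma root_node [simp]: "root (node v cs) = v"
  by (simp add: node_def split: list.split)

lemma children_node [simp]: "length cs \<le> 2 \<Longrightarrow> children (node v cs) = cs"
  by (auto simp: node_def split: list.split)

lemma node_root_children [simp]: "node (root t) (children t) = t"
  by (cases t) (auto simp: node_def)

lemma length_children: "length (children t) \<le> 2"
  by (cases t) auto

text \<open>Inverts one step of the queue: the search puts the children of the first vertex at the
  back, so a new first vertex takes the last \<open>d\<close> trees as its children. The old labels
  make room for \<open>v\<close>.\<close>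

definition attach :: "nat ub_tree list \<Rightarrow> nat \<Rightarrow> nat \<Rightarrow> nat ub_tree list" where
  "attach rs d v =
     (let us = map (map_ub_tree (shift v)) rs; k = length rs - d in node v (drop k us) # take k us)"

definition forests :: "nat \<Rightarrow> nat ub_tree list set" where
  "forests m = {ts. distinct (bfs_forest ts) \<and> set (bfs_forest ts) = {1..m} \<and>
     (\<forall>t\<in>set ts. increasing t) \<and> avoids_213 (bfs_forest ts)}"

lemma length_attach: "d \<le> length rs \<Longrightarrow> length (attach rs d v) = Suc (length rs) - d"
  by (simp add: attach_def Let_def Suc_diff_le)

lemma bfs_forest_attach:
  assumes "d \<le> 2" "d \<le> length rs"
  shows "bfs_forest (attach rs d v) = v # map (shift v) (bfs_forest rs)"
  using assms by (simp add: attach_def Let_def bfs_forest_Cons flip: bfs_forest_map)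

lemma increasing_attach:
  assumes "d \<le> 2" "d \<le> length rs"
  shows "(\<forall>t\<in>set (attach rs d v). increasing t) \<longleftrightarrow>
    (\<forall>t\<in>set rs. increasing t) \<and> (\<forall>c\<in>set (drop (length rs - d) rs). v \<le> root c)"
proof -
  define k where "k = length rs - d"
  have "length (drop k (map (map_ub_tree (shift v)) rs)) \<le> 2"
    using assms by (simp add: k_def)
  then have "(\<forall>t\<in>set (attach rs d v). increasing t) \<longleftrightarrow>
     (\<forall>c\<in>set (drop k rs). v \<le> root c \<and> increasing c) \<and> (\<forall>t\<in>set (take k rs). increasing t)"
    by (simp add: attach_def Let_def k_def[symmetric] increasing_iff_children[of "node _ _"] drop_map take_map
        root_map_ub_tree increasing_map_ub_tree[OF strict_mono_shift])
  also have "set rs = set (take k rs) \<union> set (drop k rs)"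
    by (metis append_take_drop_id set_append)
  then have "(\<forall>c\<in>set (drop k rs). v \<le> root c \<and> increasing c) \<and> (\<forall>t\<in>set (take k rs). increasing t) \<longleftrightarrow>
     (\<forall>t\<in>set rs. increasing t) \<and> (\<forall>c\<in>set (drop k rs). v \<le> root c)"
    by auto
  finally show ?thesis by (simp add: k_def)
qed

lemma set_bfs_forest: "set (bfs_forest ts) = (\<Union>t\<in>set ts. set (labels t))"
  by (metis mset_bfs_forest set_concat image_image list.set_map set_mset_mset)

lemma root_in_labels: "root t \<in> set (labels t)"
  by (cases t) auto

text \<open>By avoidance of 213, all roots lie above \<open>v\<close> as soon as the last one does, and the
  remaining vertices lie above the roots.\<close>

lemma attach_children_bound:
  assumes rs: "rs \<in> forests m" and v: "v \<ge> 1" "low_after v (bfs_forest rs)" and d: "d \<le> length rs"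
  shows "(\<forall>c\<in>set (drop (length rs - d) rs). v \<le> root c) \<longleftrightarrow> (0 < d \<longrightarrow> v = 1)"
proof (cases "d = 0")
  case False
  define w where "w = bfs_forest rs"
  have w: "set w = {1..m}" "w = map root rs @ bfs_forest (concat (map children rs))"
    using rs bfs_forest_eq[of rs] by (auto simp: forests_def w_def)
  have ne: "rs \<noteq> []" using d False by auto
  show ?thesis
  proof
    assume A: "\<forall>c\<in>set (drop (length rs - d) rs). v \<le> root c"
    have "last (drop (length rs - d) rs) = last rs" "drop (length rs - d) rs \<noteq> []"
      using d False ne by (auto simp: last_drop)
    then have "last rs \<in> set (drop (length rs - d) rs)" by (metis last_in_set)
    then have "v \<le> root (last rs)" using A by blast
    \<comment> \<open>The word starts with the roots, so this is the entry of the last root. A root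
      below \<open>v\<close> before it would contradict \<open>low_after\<close>.\<close>
    then have l: "v \<le> w ! (length rs - 1)"
      using ne by (simp add: w(2) nth_append last_conv_nth)
    have "length rs - 1 < length w" using ne by (cases rs) (simp_all add: w(2))
    then have "v \<le> w ! i" if "i < length rs - 1" for i
      using v(2)[folded w_def, unfolded low_after_iff, rule_format, of i "length rs - 1"] that l
      by (meson not_less)
    with l have "v \<le> w ! i" if "i < length rs" for i
      using that by (cases "i = length rs - 1") simp_all
    then have roots: "v \<le> root t" if "t \<in> set rs" for t
      using that by (auto simp: w(2) in_set_conv_nth nth_append)
    have "v \<le> x" if x: "x \<in> set w" for x
    proof -
      obtain t where "t \<in> set rs" "x \<in> set (labels t)"
        using x by (auto simp: w_def set_bfs_forest)
      moreover from this have "increasing t" using rs by (auto simp: forests_def)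
      ultimately show ?thesis using roots[of t] increasing_root_le[of t x] by simp
    qed
    moreover have "1 \<in> set w"
    proof -
      have "set w \<noteq> {}" using ne by (simp add: w(2))
      then show ?thesis by (simp add: w(1))
    qed
    ultimately show "0 < d \<longrightarrow> v = 1" using v by force
  next
    assume "0 < d \<longrightarrow> v = 1"
    then have "v = 1" using False by simp
    moreover have "root c \<in> set w" if "c \<in> set (drop (length rs - d) rs)" for c
      using in_set_dropD[OF that] root_in_labels[of c] by (auto simp: w_def set_bfs_forest)
    ultimately show "\<forall>c\<in>set (drop (length rs - d) rs). v \<le> root c"
      using w(1) by auto
  qed
qed simp

lemma attach_in_forests_iff:
  assumes d: "d \<le> 2" "d \<le> length rs"
  shows "attach rs d v \<in> forests (Suc m) \<longleftrightarrow>
     rs \<in> forests m \<and> v \<in> insertable (bfs_forest rs) \<and> (0 < d \<longrightarrow> v = 1)"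
proof -
  define w where "w = bfs_forest rs"
  have inj: "inj_on (shift v) A" for A
    by (metis inj_on_inverseI unshift_shift)
  have nv: "v \<notin> set (map (shift v) w)" by auto
  have set: "set (v # map (shift v) w) = {1..Suc m} \<longleftrightarrow> v \<in> {1..Suc m} \<and> set w = {1..m}"
  proof (cases "v \<in> {1..Suc m}")
    case True
    then show ?thesis using insert_shift_image[OF True, of "set w"] by simp
  next
    case False
    then show ?thesis by (metis list.set_intros(1))
  qed
  have "attach rs d v \<in> forests (Suc m) \<longleftrightarrow>
     distinct w \<and> v \<in> {1..Suc m} \<and> set w = {1..m} \<and> low_after v w \<and> avoids_213 w \<and>
     (\<forall>t\<in>set rs. increasing t) \<and> (\<forall>c\<in>set (drop (length rs - d) rs). v \<le> root c)"
    unfolding forests_def mem_Collect_eq bfs_forest_attach[OF d] increasing_attach[OF d]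
      w_def[symmetric] set avoids_213_Cons[OF nv] low_after_shift avoids_213_map[OF strict_mono_shift]
    by (auto simp: distinct_map inj)
  also have "\<dots> \<longleftrightarrow> rs \<in> forests m \<and> v \<in> {1..Suc m} \<and> low_after v w \<and>
     (\<forall>c\<in>set (drop (length rs - d) rs). v \<le> root c)"
    unfolding forests_def mem_Collect_eq w_def by blast
  also have "\<dots> \<longleftrightarrow> rs \<in> forests m \<and> v \<in> {1..Suc m} \<and> low_after v w \<and> (0 < d \<longrightarrow> v = 1)"
    using attach_children_bound[of rs m v d] d by (auto simp: w_def)
  also have "\<dots> \<longleftrightarrow> rs \<in> forests m \<and> v \<in> insertable w \<and> (0 < d \<longrightarrow> v = 1)"
    using insertable_iff[of w m v] by (auto simp: forests_def w_def)
  finally show ?thesis by (simp add: w_def)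
qed

section \<open>Enumerating the extensions of a forest\<close>

definition attachments :: "nat ub_tree list \<Rightarrow> (nat \<times> nat) set" where
  "attachments rs = {(d, v). d \<le> 2 \<and> d \<le> length rs \<and> v \<in> insertable (bfs_forest rs) \<and> (0 < d \<longrightarrow> v = 1)}"

text \<open>\<open>v\<close> is the root of the first tree, \<open>d\<close> the number of its
  children, and \<open>unshift v\<close> recovers the old labels.\<close>

lemma attach_inject:
  assumes "d \<le> 2" "d \<le> length rs" "d' \<le> 2" "d' \<le> length rs'" and eq: "attach rs d v = attach rs' d' v'"
  shows "rs = rs' \<and> d = d' \<and> v = v'"
proof -
  define k k' where kk: "k = length rs - d" "k' = length rs' - d'"
  define us us' where uu: "us = map (map_ub_tree (shift v)) rs" "us' = map (map_ub_tree (shift v')) rs'"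
  have n: "node v (drop k us) = node v' (drop k' us')" and t: "take k us = take k' us'"
    using eq by (simp_all add: attach_def Let_def kk uu)
  have v: "v = v'" using n by (metis root_node)
  have len: "length (drop k us) = d" "length (drop k' us') = d'"
    using assms by (simp_all add: kk uu)
  then have dr: "drop k us = drop k' us'" using n assms by (metis children_node)
  have "us = us'" using t dr by (metis append_take_drop_id)
  moreover have "rs = map (map_ub_tree (unshift v)) us" "rs' = map (map_ub_tree (unshift v)) us'"
    using v by (simp_all add: uu ub_tree.map_comp comp_def ub_tree.map_ident)
  moreover have "d = d'" using len dr by simp
  ultimately show ?thesis using v by simp
qed

lemma ex_attach:
  assumes "ts \<in> forests (Suc m)"
  obtains rs d v where "d \<le> 2" "d \<le> length rs" "ts = attach rs d v"
proof -
  have "ts \<noteq> []" using assms by (auto simp: forests_def)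
  then obtain t us where ts: "ts = t # us" by (cases ts) auto
  define v d rs where "v = root t" and "d = length (children t)"
    and "rs = map (map_ub_tree (unshift v)) (us @ children t)"
  have nv: "v \<notin> set (bfs_forest (us @ children t))"
    using assms by (auto simp: forests_def ts bfs_forest_Cons v_def)
  have "map_ub_tree (shift v \<circ> unshift v) s = s" if "s \<in> set (us @ children t)" for s
  proof (rule ub_tree.map_ident_strong)
    fix x assume "x \<in> set_ub_tree s"
    with that nv have "x \<noteq> v" unfolding set_bfs_forest set_ub_tree_eq by blast
    then show "(shift v \<circ> unshift v) x = x" by (simp add: shift_unshift)
  qed
  then have "map (map_ub_tree (shift v)) rs = us @ children t"
    unfolding rs_def map_map by (intro map_idI) (simp add: ub_tree.map_comp)
  moreover have "length rs - d = length us" by (simp add: rs_def d_def)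
  ultimately have "ts = attach rs d v"
    by (simp add: attach_def Let_def ts v_def)
  moreover have "d \<le> 2" "d \<le> length rs"
    using length_children[of t] by (auto simp: d_def rs_def)
  ultimately show thesis using that by blast
qed

lemma bij_betw_attach:
  "bij_betw (\<lambda>(rs, d, v). attach rs d v) (SIGMA rs:forests m. attachments rs) (forests (Suc m))"
  unfolding bij_betw_def
proof
  show "inj_on (\<lambda>(rs, d, v). attach rs d v) (SIGMA rs:forests m. attachments rs)"
    by (auto simp: inj_on_def attachments_def dest: attach_inject)
  show "(\<lambda>(rs, d, v). attach rs d v) ` (SIGMA rs:forests m. attachments rs) = forests (Suc m)" (is "?L = ?R")
  proof
    show "?L \<subseteq> ?R" by (auto simp: attachments_def attach_in_forests_iff)
    show "?R \<subseteq> ?L"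
    proof
      fix ts assume ts: "ts \<in> ?R"
      obtain rs d v where d: "d \<le> 2" "d \<le> length rs" and eq: "ts = attach rs d v"
        using ex_attach[OF ts] .
      then have "(rs, d, v) \<in> (SIGMA rs:forests m. attachments rs)"
        using ts by (simp add: attach_in_forests_iff attachments_def)
      then show "ts \<in> ?L" using eq by force
    qed
  qed
qed

lemma forests_0: "forests 0 = {[]}"
proof -
  have "bfs_forest ts = [] \<longleftrightarrow> ts = []" for ts :: "nat ub_tree list"
    by (cases ts) (auto simp: bfs_forest_Cons)
  then have "ts \<in> forests 0 \<Longrightarrow> ts = []" for ts
    by (simp add: forests_def)
  moreover have "[] \<in> forests 0"
    by (simp add: forests_def avoids_213_def)
  ultimately show ?thesis by blast
qed

lemma finite_attachments: "finite (attachments rs)"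
proof (rule finite_subset)
  show "attachments rs \<subseteq> {..2} \<times> insertable (bfs_forest rs)" by (auto simp: attachments_def)
qed (simp add: insertable_def finite_lr_minima)

lemma finite_forests: "finite (forests m)"
proof (induction m)
  case (Suc m)
  then show ?case
    using bij_betw_finite[OF bij_betw_attach[of m]] by (simp add: finite_attachments)
qed (simp add: forests_0)

definition minima_count :: "nat ub_tree list \<Rightarrow> nat" where
  "minima_count ts = card (lr_minima (bfs_forest ts))"

text \<open>The three summands are \<open>d = 0, 1, 2\<close>. For \<open>d > 0\<close> the new
  first label is 1, the smallest, hence the only left-to-right minimum.\<close>

lemma sum_attachments:
  fixes h :: "nat \<Rightarrow> nat \<Rightarrow> 'b::comm_monoid_add"
  assumes rs: "rs \<in> forests m"
  shows "(\<Sum>(d, v)\<in>attachments rs. h (length (attach rs d v)) (minima_count (attach rs d v))) =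
    (\<Sum>i\<le>minima_count rs. h (Suc (length rs)) (Suc i)) +
    (if 1 \<le> length rs then h (length rs) 1 else 0) +
    (if 2 \<le> length rs then h (length rs - 1) 1 else 0)"
proof -
  define w where "w = bfs_forest rs"
  have w: "distinct w" "set w = {1..m}" "avoids_213 w"
    using rs by (simp_all add: forests_def w_def)
  have "length w = m" using w distinct_card[of w] by simp
  have one: "1 \<in> insertable w"
    using insertable_iff[OF w, of 1] low_after_least[of w 1] w(2) by auto
  have mc: "minima_count (attach rs d v) = card (lr_minima (v # map (shift v) w))"
    if "d \<le> 2" "d \<le> length rs" for d v
    using that by (simp add: minima_count_def bfs_forest_attach w_def)
  have mc1: "card (lr_minima (1 # map (shift 1) w)) = 1"
  proof -
    have "{x \<in> lr_minima (map (shift 1) w). x < 1} = {}"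
      using lr_minima_subset[of w] w(2) by (auto simp: lr_minima_map[OF strict_mono_shift] shift_def)
    then show ?thesis by (simp del: One_nat_def)
  qed
  let ?f = "\<lambda>(d, v). h (length (attach rs d v)) (minima_count (attach rs d v))"
  let ?A = "\<lambda>d. if d \<le> length rs then {(d, 1 :: nat)} else {}"
  have "attachments rs = ({0} \<times> insertable w \<union> ?A 1) \<union> ?A 2"
    using one by (auto simp: attachments_def w_def le_Suc_eq numeral_2_eq_2)
  then have "sum ?f (attachments rs) = sum ?f ({0} \<times> insertable w) + sum ?f (?A 1) + sum ?f (?A 2)"
    using sum.union_disjoint[of "{0} \<times> insertable w \<union> ?A 1" "?A 2" ?f]
      sum.union_disjoint[of "{0} \<times> insertable w" "?A 1" ?f]
    by (auto simp: insertable_def finite_lr_minima)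
  also have "sum ?f ({0} \<times> insertable w) = (\<Sum>v\<in>insertable w. h (Suc (length rs)) (card (lr_minima (v # map (shift v) w))))"
    by (simp add: sum.cartesian_product[symmetric] length_attach mc del: lr_minima.simps)
  also have "\<dots> = (\<Sum>i\<le>minima_count rs. h (Suc (length rs)) (Suc i))"
    using sum_insertable[OF w(2) \<open>length w = m\<close>] by (simp add: minima_count_def w_def)
  also have "sum ?f (?A 1) = (if 1 \<le> length rs then h (length rs) 1 else 0)"
    using mc[of 1 1] mc1 by (simp add: length_attach del: lr_minima.simps)
  also have "sum ?f (?A 2) = (if 2 \<le> length rs then h (length rs - 1) 1 else 0)"
    using mc[of 2 1] mc1 by (simp add: length_attach del: lr_minima.simps)
  finally show ?thesis .
qed

lemma sum_forests_Suc:
  fixes h :: "nat \<Rightarrow> nat \<Rightarrow> 'b::comm_monoid_add"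
  shows "(\<Sum>ts\<in>forests (Suc m). h (length ts) (minima_count ts)) =
    (\<Sum>rs\<in>forests m. (\<Sum>i\<le>minima_count rs. h (Suc (length rs)) (Suc i)) +
       (if 1 \<le> length rs then h (length rs) 1 else 0) +
       (if 2 \<le> length rs then h (length rs - 1) 1 else 0))"
proof -
  have "(\<Sum>ts\<in>forests (Suc m). h (length ts) (minima_count ts)) =
      (\<Sum>(rs, d, v)\<in>(SIGMA rs:forests m. attachments rs). h (length (attach rs d v)) (minima_count (attach rs d v)))"
    by (subst sum.reindex_bij_betw[OF bij_betw_attach, symmetric]) (simp add: case_prod_unfold)
  also have "\<dots> = (\<Sum>rs\<in>forests m. \<Sum>(d, v)\<in>attachments rs. h (length (attach rs d v)) (minima_count (attach rs d v)))"
    by (rule sum.Sigma[symmetric]) (auto simp: finite_forests finite_attachments)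
  finally show ?thesis by (simp add: sum_attachments cong: sum.cong)
qed

subsection \<open>Weighted counting of forests\<close>

text \<open>Here the forest has \<open>q + 1\<close> trees and \<open>j + 1\<close> minima; the
  right side collects new vertices with no, one and two children. Increasing \<open>j\<close> adds
  one term to the sum, which matches \<open>c = 1 + X * T * c\<^sup>2\<close>.\<close>

lemma forest_weight:
  fixes X T P c :: "'a::idom"
  assumes P: "P * (1 + T) = T" and c: "c = 1 + T * P" and PX: "P = X * c\<^sup>2"
  shows "T ^ Suc q * c ^ j = X * ((\<Sum>i\<le>Suc j. T ^ (q + 2) * c ^ i) + T ^ Suc q + T ^ q)"
proof (induction j)
  case 0
  \<comment> \<open>By \<open>1 + T + T\<^sup>2 = c * (1 + T)\<close> the bracket equals
    \<open>c\<^sup>2 * (1 + T)\<close>, and \<open>X\<close> times this is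
    \<open>P * (1 + T)\<close>.\<close>
  have "T = X * (T\<^sup>2 * (1 + c) + T + 1)"
    using c P PX by algebra
  then have "T * T ^ q = X * (T\<^sup>2 * (1 + c) + T + 1) * T ^ q"
    by (rule arg_cong)
  also have "\<dots> = X * ((\<Sum>i\<le>Suc 0. T ^ (q + 2) * c ^ i) + T ^ Suc q + T ^ q)"
    by (simp add: algebra_simps power2_eq_square)
  finally show ?case by simp
next
  case (Suc j)
  have "c = 1 + X * T * c\<^sup>2" using c PX by (simp add: mult.assoc mult.left_commute)
  then have "T ^ Suc q * c ^ Suc j = T ^ Suc q * c ^ j * (1 + X * T * c\<^sup>2)"
    by (metis mult.assoc power_Suc2)
  also have "\<dots> = T ^ Suc q * c ^ j + X * (T ^ (q + 2) * c ^ Suc (Suc j))"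
    by (simp add: algebra_simps power2_eq_square)
  also have "\<dots> = X * ((\<Sum>i\<le>Suc (Suc j). T ^ (q + 2) * c ^ i) + T ^ Suc q + T ^ q)"
    unfolding Suc by (simp add: algebra_simps)
  finally show ?case .
qed

text \<open>By \<open>step\<close>, passing from \<open>S m\<close> to \<open>S (m + 1)\<close>
  lowers the coefficient index by one, while \<open>N m\<close> enters only at index 1. Starting
  from \<open>S 1 = T\<close>, the coefficient of index \<open>n\<close> becomes that of index 1 in
  \<open>S n\<close>, which is \<open>N n\<close>.\<close>

lemma card_single_tree_forests:
  fixes T P c :: "'a::idom fps"
  assumes T0: "T $ 0 = 0" and P: "P * (1 + T) = T" and c: "c = 1 + T * P" and PX: "P = fps_X * c\<^sup>2"
    and n: "0 < n"
  shows "of_nat (card {ts \<in> forests n. length ts = 1}) = T $ n"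
proof -
  define N where "N m = card {ts \<in> forests m. length ts = 1}" for m
  define S where "S m = (\<Sum>ts\<in>forests m. T ^ length ts * c ^ (minima_count ts - 1))" for m
  \<comment> \<open>Thus the exponent \<open>minima_count ts - 1\<close> is a true difference on
    nonempty forests.\<close>
  have pos: "1 \<le> length ts \<and> 1 \<le> minima_count ts" if "ts \<in> forests (Suc m)" for ts m
  proof -
    have "ts \<noteq> []" using that by (auto simp: forests_def)
    then have "lr_minima (bfs_forest ts) \<noteq> {}" by (cases ts) (auto simp: bfs_forest_Cons)
    then show ?thesis
      using \<open>ts \<noteq> []\<close> finite_lr_minima[of "bfs_forest ts"]
      by (simp add: minima_count_def Suc_le_eq card_gt_0_iff)
  qed
  have S1: "S 1 = T"
    using sum_forests_Suc[where m = 0 and h = "\<lambda>q j. T ^ q * c ^ (j - 1)"]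
    by (simp add: S_def forests_0 minima_count_def)
  have step: "S (Suc m) = fps_X * (S (Suc (Suc m)) + of_nat (N (Suc m)))" for m
  proof -
    \<comment> \<open>A single tree cannot give two children to a new vertex, yet
      \<open>forest_weight\<close> has the term \<open>T ^ 0\<close> there; the last summand
      supplies it.\<close>
    have "S (Suc m) = (\<Sum>ts\<in>forests (Suc m). fps_X *
        ((\<Sum>i\<le>minima_count ts. T ^ Suc (length ts) * c ^ (Suc i - 1)) +
         (if 1 \<le> length ts then T ^ length ts * c ^ (1 - 1) else 0) +
         (if 2 \<le> length ts then T ^ (length ts - 1) * c ^ (1 - 1) else 0) +
         (if length ts = 1 then 1 else 0)))"
      unfolding S_def
    proof (rule sum.cong)
      fix ts assume "ts \<in> forests (Suc m)"
      from pos[OF this] obtain q j where "length ts = Suc q" "minima_count ts = Suc j"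
        by (metis One_nat_def Suc_le_D)
      then show "T ^ length ts * c ^ (minima_count ts - 1) = fps_X *
        ((\<Sum>i\<le>minima_count ts. T ^ Suc (length ts) * c ^ (Suc i - 1)) +
         (if 1 \<le> length ts then T ^ length ts * c ^ (1 - 1) else 0) +
         (if 2 \<le> length ts then T ^ (length ts - 1) * c ^ (1 - 1) else 0) +
         (if length ts = 1 then 1 else 0))"
        using forest_weight[OF P c PX, of q j] by (cases q) simp_all
    qed simp
    also have "\<dots> = fps_X * (S (Suc (Suc m)) + (\<Sum>ts\<in>forests (Suc m). if length ts = 1 then 1 else 0))"
      unfolding S_def sum_forests_Suc[where m = "Suc m" and h = "\<lambda>q j. T ^ q * c ^ (j - 1)"]
      by (simp only: sum_distrib_left[symmetric] sum.distrib[symmetric])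
    also have "(\<Sum>ts\<in>forests (Suc m). if length ts = 1 then 1 else 0) = (of_nat (N (Suc m)) :: 'a fps)"
      by (simp add: N_def finite_forests sum.If_cases Int_def)
    finally show ?thesis .
  qed
  have nth0: "S (Suc m) $ 0 = 0" for m
    by (subst step) simp
  have "S (Suc m) $ Suc k = S (Suc (m + k)) $ 1" for m k
  proof (induction k arbitrary: m)
    case (Suc k)
    have "S (Suc m) $ Suc (Suc k) = S (Suc (Suc m)) $ Suc k"
      by (subst step) (simp add: fps_of_nat[symmetric])
    then show ?case using Suc[of "Suc m"] by simp
  qed simp
  from this[of 0 "n - 1"] have "T $ n = S n $ 1" using S1 n by simp
  also have "\<dots> = of_nat (N n)"
    using step[of "n - 1"] nth0[of n] n by (simp add: fps_of_nat[symmetric])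
  finally show ?thesis by (simp add: N_def)
qed

section \<open>From single-tree forests to trees, and the comparison of both counts\<close>

lemma card_avoiding_trees:
  "card {t \<in> increasing_ub_trees n. avoids_213 (associated_permutation t)} =
   card {ts \<in> forests n. length ts = 1}"
proof -
  have "t \<in> increasing_ub_trees n \<and> avoids_213 (associated_permutation t) \<longleftrightarrow> [t] \<in> forests n" for t
  proof -
    have m: "mset (bfs_forest [t]) = mset (labels t)" by (simp add: mset_bfs_forest)
    have "distinct (bfs_forest [t]) = distinct (labels t)" "set (bfs_forest [t]) = set (labels t)"
      using mset_eq_imp_distinct_iff[OF m] mset_eq_setD[OF m] by auto
    then show ?thesis
      using distinct_card[of "labels t"]
      by (auto simp: increasing_ub_trees_def forests_def associated_permutation_def)
  qed
  then have "{ts \<in> forests n. length ts = 1} = (\<lambda>t. [t]) ` {t \<in> increasing_ub_trees n. avoids_213 (associated_permutation t)}"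
    by (auto simp: length_Suc_conv image_iff)
  then show ?thesis by (simp add: card_image inj_on_def)
qed

theorem theorem1:
  fixes n :: nat
  shows "card (positive_walks_0_1 n) =
         card {t \<in> increasing_ub_trees n. avoids_213 (associated_permutation t)}"
proof -
  obtain T P c :: "rat fps"
    where T: "T $ 0 = 0" "P * (1 + T) = T" "c = 1 + T * P" "P = fps_X * c\<^sup>2"
    by (rule walk_series_exists)
  \<comment> \<open>For \<open>n = 0\<close> both sides vanish: the only forest without vertices is
    empty, and \<open>T\<close> has no constant term.\<close>
  have "of_nat (card {ts \<in> forests n. length ts = 1}) = T $ n"
    using card_single_tree_forests[OF T] T(1) by (cases "n = 0") (simp_all add: forests_0)
  then have "(of_nat (card (positive_walks_0_1 n)) :: rat) = of_nat (card {ts \<in> forests n. length ts = 1})"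
    using card_positive_walks_0_1[OF T] by simp
  then show ?thesis
    by (simp only: card_avoiding_trees of_nat_eq_iff)
qed

end
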